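(* Let $\vec a=(a_1,\ldots,a_n)$ be a vector of relatively prime positive integers, let $d_i=\gcd(\vec a_{-i})$ for $1\le i\le n$, and let $p=d_1\cdots d_n$. Then there are constants $C_1,C_2$ (depending on $\vec a$) such that, for all sufficiently large $s\in\mathbb{Z}_{\ge 0}$, writing $k=f(sp)$: \begin{align*} g_{=k}=g_{\le k}&=sp+\sum_{i=1}^n(d_i-1)a_i,\\ h_{=k}=h_{\ge k}&=sp,\\ c_{=k}&=p,\\ c_{\le k}&=sp+C_1,\\ s_{=k}&=sp^2+\sum_{i=1}^n\frac{pa_i(d_i-1)}{2},\\ s_{\le k}&=\frac{1}{2}(sp)^2+\left(\frac{p+\sum_{i=1}^n a_i(d_i-1)}{2}\right)sp+C_2,\\ F_{=k}(x)&=x^{sp}\prod_{i=1}^n\frac{1-x^{d_ia_i}}{1-x^{a_i}},\\ F_{\ge k}(x)&=\frac{x^{sp}}{1-x^p}\prod_{i=1}^n\frac{1-x^{d_ia_i}}{1-x^{a_i}}. \end{align*}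
   Context: For $t\in\mathbb{Z}_{\ge 0}$, $f(t)=f(\vec a;t)=\#\{(x_1,\ldots,x_n)\in\mathbb{Z}_{\ge 0}^n:\ a_1x_1+\cdots+a_nx_n=t\}$. $\vec a_{-i}$ denotes $\vec a$ with the $i$th entry removed. For $k\in\mathbb{Z}_{\ge0}$: $g_{=k}$ (resp. $g_{\le k}$) is the maximum $t\in\mathbb{Z}_{\ge 0}$ with $f(t)=k$ (resp. $f(t)\le k$); $h_{=k}$ (resp. $h_{\ge k}$) is the minimum $t\in\mathbb{Z}_{\ge 0}$ with $f(t)=k$ (resp. $f(t)\ge k$); $c_{=k}$ (resp. $c_{\le k}$) is the number of $t\in\mathbb{Z}_{\ge 0}$ with $f(t)=k$ (resp. $f(t)\le k$); $s_{=k}$ (resp. $s_{\le k}$) is the sum of all $t\in\mathbb{Z}_{\ge 0}$ with $f(t)=k$ (resp. $f(t)\le k$); $F_{=k}(x)=\sum_{t\in\mathbb{Z}_{\ge0}:\,f(t)=k}x^t$ and $F_{\ge k}(x)=\sum_{t\in\mathbb{Z}_{\ge0}:\,f(t)\ge k}x^t$. *)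

theory Defs
  imports Complex_Main "HOL-Computational_Algebra.Formal_Power_Series"
begin

text \<open>
  Vectors are lists, so the entries of \<open>a\<close> are \<open>a ! i\<close> for \<open>i < length a\<close>.
  If all entries of \<open>a\<close> are positive, the set of solutions in \<open>nrep\<close> is finite.
\<close>

definition nrep :: "nat list \<Rightarrow> nat \<Rightarrow> nat" where
  "nrep a t = card {x :: nat list. length x = length a \<and> (\<Sum>i<length a. a ! i * x ! i) = t}"

definition omit :: "nat \<Rightarrow> 'a list \<Rightarrow> 'a list" where
  "omit i a = take i a @ drop (Suc i) a"

text \<open>
  The functions \<open>g\<close>, \<open>c\<close>, \<open>s\<close> have their intended meaning only if the underlying set is finite
  (and nonempty for \<open>g\<close>), and \<open>h\<close> only if it is nonempty.
\<close>

definition g_eq :: "nat list \<Rightarrow> nat \<Rightarrow> nat" where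
  "g_eq a k = Max {t. nrep a t = k}"

definition g_le :: "nat list \<Rightarrow> nat \<Rightarrow> nat" where
  "g_le a k = Max {t. nrep a t \<le> k}"

definition h_eq :: "nat list \<Rightarrow> nat \<Rightarrow> nat" where
  "h_eq a k = (LEAST t. nrep a t = k)"

definition h_ge :: "nat list \<Rightarrow> nat \<Rightarrow> nat" where
  "h_ge a k = (LEAST t. nrep a t \<ge> k)"

definition c_eq :: "nat list \<Rightarrow> nat \<Rightarrow> nat" where
  "c_eq a k = card {t. nrep a t = k}"

definition c_le :: "nat list \<Rightarrow> nat \<Rightarrow> nat" where
  "c_le a k = card {t. nrep a t \<le> k}"

definition s_eq :: "nat list \<Rightarrow> nat \<Rightarrow> nat" where
  "s_eq a k = \<Sum>{t. nrep a t = k}"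

definition s_le :: "nat list \<Rightarrow> nat \<Rightarrow> nat" where
  "s_le a k = \<Sum>{t. nrep a t \<le> k}"

definition F_eq :: "nat list \<Rightarrow> nat \<Rightarrow> real fps" where
  "F_eq a k = Abs_fps (\<lambda>t. if nrep a t = k then 1 else 0)"

definition F_ge :: "nat list \<Rightarrow> nat \<Rightarrow> real fps" where
  "F_ge a k = Abs_fps (\<lambda>t. if nrep a t \<ge> k then 1 else 0)"

end

theory Submission
  imports Defs "HOL-Library.Landau_Symbols" "HOL-Number_Theory.Cong"
begin

text \<open>
  The \<open>d i\<close> are pairwise coprime, \<open>d i\<close> is coprime to \<open>a ! i\<close> and divides every other entry. Hence
  each \<open>t\<close> is uniquely \<open>t = (\<Sum>i<n. a ! i * r i) + p q\<close> with \<open>0 \<le> r i < d i\<close> and an integer \<open>q\<close>, and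
  the solutions for \<open>t\<close> are \<open>x i = r i + d i * y i\<close> with \<open>y\<close> a solution for \<open>q\<close> with respect to the vector
  \<open>b i = a ! i * d i / p\<close>. So the number of representations depends on \<open>q\<close> only, and everything follows
  once the number of representations by \<open>b\<close> is known to be eventually strictly increasing.

  Any \<open>n - 1\<close> entries of \<open>b\<close> are coprime. Let \<open>H\<close> be the generating function of the representations
  by \<open>b\<close>, and call a series small if its coefficients are \<open>o(t^(n-2))\<close>. For \<open>i \<noteq> j\<close> the series
  \<open>(1 - X^(b i)) (1 - X^(b j)) H\<close> is small, and the set of \<open>m\<close> for which \<open>(1 - X^m) W\<close> is small is closed
  under greatest common divisors, so \<open>(1 - X)^2 H\<close> is small. Thus \<open>D = (1 - X) H\<close> varies slowly, while
  its sums over windows of length \<open>b i\<close> and then \<open>b j\<close> count representations of numbers up to \<open>t\<close> by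
  the other \<open>n - 2\<close> entries and are at least \<open>c t^(n-2)\<close>. Hence \<open>D\<close> has eventually positive coefficients.
\<close>

section \<open>Growth of the generating function\<close>

definition small_fps :: "nat \<Rightarrow> real fps set" where
  "small_fps k = {w. fps_nth w \<in> o(\<lambda>t. real t ^ k)}"

lemma small_fps_add: "v \<in> small_fps k \<Longrightarrow> w \<in> small_fps k \<Longrightarrow> v + w \<in> small_fps k"
  using sum_in_smallo(1)[of "fps_nth v" _ _ "fps_nth w"]
  unfolding small_fps_def mem_Collect_eq fps_add_nth[symmetric] .

lemma small_fps_diff: "v \<in> small_fps k \<Longrightarrow> w \<in> small_fps k \<Longrightarrow> v - w \<in> small_fps k"
  using sum_in_smallo(2)[of "fps_nth v" _ _ "fps_nth w"]
  unfolding small_fps_def mem_Collect_eq fps_sub_nth[symmetric] .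

lemma small_fps_0: "0 \<in> small_fps k"
proof -
  have "fps_nth (0 :: real fps) = (\<lambda>_. 0)" by auto
  then show ?thesis by (simp add: small_fps_def)
qed

lemma small_fps_sum: "(\<And>i. i \<in> I \<Longrightarrow> f i \<in> small_fps k) \<Longrightarrow> (\<Sum>i\<in>I. f i) \<in> small_fps k"
  by (induction I rule: infinite_finite_induct) (auto intro: small_fps_add small_fps_0)

lemma small_fps_X_power_mult:
  assumes "w \<in> small_fps k"
  shows "fps_X ^ m * w \<in> small_fps k"
  unfolding small_fps_def mem_Collect_eq
proof (rule landau_o.smallI)
  fix c :: real assume c: "c > 0"
  have "eventually (\<lambda>t. norm (fps_nth w t) \<le> c * norm (real t ^ k)) sequentially"
    using assms c landau_o.smallD unfolding small_fps_def by blast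
  then obtain T where T: "\<And>t. t \<ge> T \<Longrightarrow> \<bar>fps_nth w t\<bar> \<le> c * real t ^ k"
    by (auto simp: eventually_sequentially)
  \<comment> \<open>The coefficient at \<open>t\<close> is the one of \<open>w\<close> at
    \<open>t - m\<close>. Beyond \<open>T + m\<close> that index is at least \<open>T\<close>, and
    passing from \<open>t - m\<close> back to \<open>t\<close> only enlarges the bound.\<close>
  have "norm (fps_nth (fps_X ^ m * w) t) \<le> c * norm (real t ^ k)" if "t \<ge> T + m" for t
  proof -
    have "\<bar>fps_nth w (t - m)\<bar> \<le> c * real (t - m) ^ k" using that by (intro T) simp
    also have "\<dots> \<le> c * real t ^ k" using c by (intro mult_left_mono power_mono) auto
    finally show ?thesis using that by (simp add: fps_X_power_mult_nth)
  qed
  then show "eventually (\<lambda>t. norm (fps_nth (fps_X ^ m * w) t) \<le> c * norm (real t ^ k)) sequentially"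
    unfolding eventually_sequentially by blast
qed

section \<open>Closure of shift lengths under greatest common divisors\<close>

lemma gcd_closed_if_add_diff_closed:
  fixes K :: "nat set"
  assumes add: "\<And>x y. x \<in> K \<Longrightarrow> y \<in> K \<Longrightarrow> x + y \<in> K"
    and diff: "\<And>x y. x \<in> K \<Longrightarrow> y \<in> K \<Longrightarrow> x - y \<in> K"
  shows "x \<in> K \<Longrightarrow> y \<in> K \<Longrightarrow> gcd x y \<in> K"
\<comment> \<open>Subtractive Euclidean algorithm: taking the smaller number from the larger keeps
  the gcd and lowers the sum.\<close>
proof (induction "x + y" arbitrary: x y rule: less_induct)
  case less
  consider "x = 0 \<or> y = 0" | "x > 0" "y > 0" "x \<le> y" | "x > 0" "y > 0" "y \<le> x" by linarith
  then show ?case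
  proof cases
    case 1
    then show ?thesis using less.prems by auto
  next
    case 2
    then have "gcd x (y - x) \<in> K" using less.hyps[of x "y - x"] less.prems diff by simp
    then show ?thesis using 2 by (metis gcd.commute gcd_diff1_nat)
  next
    case 3
    then have "gcd (x - y) y \<in> K" using less.hyps[of "x - y" y] less.prems diff by simp
    then show ?thesis using 3 by (metis gcd_diff1_nat)
  qed
qed

lemma Gcd_closed_if_add_diff_closed:
  fixes K :: "nat set"
  assumes "\<And>x y. x \<in> K \<Longrightarrow> y \<in> K \<Longrightarrow> x + y \<in> K"
    and "\<And>x y. x \<in> K \<Longrightarrow> y \<in> K \<Longrightarrow> x - y \<in> K" and "0 \<in> K"
  shows "finite B \<Longrightarrow> B \<subseteq> K \<Longrightarrow> Gcd B \<in> K"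
proof (induction B rule: finite_induct)
  case (insert x B)
  then show ?case using gcd_closed_if_add_diff_closed[of K x "Gcd B"] assms(1,2) by simp
qed (use assms(3) in simp)

text \<open>A difference over a long step is a sum of shifted differences over shorter ones, and
  shifting preserves smallness. So the admissible step lengths are closed under addition and
  subtraction, hence under gcds.\<close>

lemma small_fps_Gcd:
  assumes "finite B" and "\<And>b. b \<in> B \<Longrightarrow> (1 - fps_X ^ b) * w \<in> small_fps k"
  shows "(1 - fps_X ^ Gcd B) * w \<in> small_fps k"
proof -
  define K where "K = {m. (1 - fps_X ^ m) * w \<in> small_fps k}"
  have "x + y \<in> K" if "x \<in> K" "y \<in> K" for x y
  proof -
    have "(1 - fps_X ^ (x + y)) * w = (1 - fps_X ^ x) * w + fps_X ^ x * ((1 - fps_X ^ y) * w)"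
      by (simp add: algebra_simps power_add)
    then show ?thesis
      using that small_fps_add small_fps_X_power_mult unfolding K_def by simp
  qed
  moreover have "0 \<in> K" by (simp add: K_def small_fps_0)
  moreover have "x - y \<in> K" if "x \<in> K" "y \<in> K" for x y
  \<comment> \<open>For \<open>y > x\<close> truncated subtraction gives 0, which is admissible
    because \<open>1 - fps_X ^ 0\<close> vanishes.\<close>
  proof (cases "y \<le> x")
    case True
    have *: "fps_X ^ x = fps_X ^ (x - y) * (fps_X ^ y :: real fps)"
      using True by (simp flip: power_add)
    have "(1 - fps_X ^ (x - y)) * w = (1 - fps_X ^ x) * w - fps_X ^ (x - y) * ((1 - fps_X ^ y) * w)"
      unfolding * by (simp add: algebra_simps)
    then show ?thesis
      using that small_fps_diff small_fps_X_power_mult unfolding K_def by simp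
  qed (use \<open>0 \<in> K\<close> in simp)
  ultimately have "Gcd B \<in> K"
    using assms by (intro Gcd_closed_if_add_diff_closed) (auto simp: K_def)
  then show ?thesis by (simp add: K_def)
qed

section \<open>Products of geometric series and bounds on their coefficients\<close>

definition rep_fps :: "('i \<Rightarrow> nat) \<Rightarrow> 'i set \<Rightarrow> real fps" where
  "rep_fps b J = inverse (\<Prod>j\<in>J. 1 - fps_X ^ b j)"

lemma one_minus_X_power_nth_0: "b > 0 \<Longrightarrow> fps_nth (1 - fps_X ^ b :: real fps) 0 = 1"
  by simp

lemma one_minus_X_power_neq_0: "b > 0 \<Longrightarrow> (1 - fps_X ^ b :: real fps) \<noteq> 0"
  using one_minus_X_power_nth_0[of b] by (metis fps_zero_nth zero_neq_one)

lemma rep_fps_remove: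
  assumes "finite J" "j \<in> J" "b j > 0"
  shows "(1 - fps_X ^ b j) * rep_fps b J = rep_fps b (J - {j})"
proof -
  have "rep_fps b J = inverse (1 - fps_X ^ b j) * rep_fps b (J - {j})"
    unfolding rep_fps_def by (simp add: prod.remove[OF assms(1,2)] fps_inverse_mult)
  moreover have "(1 - fps_X ^ b j) * inverse (1 - fps_X ^ b j :: real fps) = 1"
    using assms(3) by (intro inverse_mult_eq_1') simp
  ultimately show ?thesis by (simp only: mult.assoc[symmetric] mult_1)
qed

text \<open>Unrolling the recurrence \<open>u t = v t + u (t - b)\<close>. The sum ends at
  \<open>t div b\<close>, so no subtraction in it is truncated.\<close>

lemma nth_eq_sum_if_one_minus_X_power_mult:
  fixes u v :: "real fps"
  assumes "b > 0" and "(1 - fps_X ^ b) * u = v"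
  shows "fps_nth u t = (\<Sum>j\<le>t div b. fps_nth v (t - b * j))"
proof (induction t rule: less_induct)
  case (less t)
  have "fps_nth u t = fps_nth v t + (if t < b then 0 else fps_nth u (t - b))"
    unfolding assms(2)[symmetric] by (simp add: left_diff_distrib fps_X_power_mult_nth)
  also have "\<dots> = (\<Sum>j\<le>t div b. fps_nth v (t - b * j))"
  proof (cases "t < b")
    case False
    then have *: "t div b = Suc ((t - b) div b)" using assms(1) by (simp add: le_div_geq)
    show ?thesis
      unfolding * sum.atMost_Suc_shift using False less[of "t - b"] assms(1) by simp
  qed simp
  finally show ?case .
qed

text \<open>Each further entry replaces a coefficient by a sum of at most \<open>t + 1\<close>
  earlier ones. The first entry, split off as \<open>j\<close>, contributes only the factor
  1.\<close>

lemma rep_fps_upper_bound: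
  assumes "finite J" and "j \<notin> J" and "\<And>i. i \<in> insert j J \<Longrightarrow> b i > 0"
  shows "\<bar>fps_nth (rep_fps b (insert j J)) t\<bar> \<le> real (t + 1) ^ card J"
  using assms
proof (induction J arbitrary: j t rule: finite_induct)
  case empty
  then have "(1 - fps_X ^ b j) * rep_fps b {j} = rep_fps b {}"
    using rep_fps_remove[of "{j}" j b] by simp
  then have *: "fps_nth (rep_fps b {j}) t = (\<Sum>i\<le>t div b j. fps_nth 1 (t - b j * i))"
    using nth_eq_sum_if_one_minus_X_power_mult[of "b j"] empty by (simp add: rep_fps_def)
  \<comment> \<open>The series 1 has a nonzero coefficient only at 0, which the index can reach only
    at the last summand.\<close>
  have "(\<Sum>i\<le>t div b j. fps_nth (1 :: real fps) (t - b j * i))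
      \<le> (\<Sum>i\<le>t div b j. if i = t div b j then 1 else 0)"
  proof (rule sum_mono)
    fix i assume i: "i \<in> {..t div b j}"
    have "i = t div b j" if "t - b j * i = 0"
    proof -
      have "t div b j \<le> b j * i div b j" using that by (intro div_le_mono) simp
      then show ?thesis using i empty.prems(2) by simp
    qed
    then show "fps_nth (1 :: real fps) (t - b j * i) \<le> (if i = t div b j then 1 else 0)" by auto
  qed
  moreover have "(\<Sum>i\<le>t div b j. fps_nth (1 :: real fps) (t - b j * i)) \<ge> 0"
    by (rule sum_nonneg) auto
  ultimately show ?case unfolding * by simp
next
  case (insert i J)
  have bj: "b j > 0" using insert.prems(2) by blast
  have "(1 - fps_X ^ b j) * rep_fps b (insert j (insert i J)) = rep_fps b (insert i J)"
    using rep_fps_remove[of "insert j (insert i J)" j b] insert.hyps(1) insert.prems(1) bj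
    by (metis Diff_insert_absorb finite_insert insertI1)
  then have "fps_nth (rep_fps b (insert j (insert i J))) t
      = (\<Sum>l\<le>t div b j. fps_nth (rep_fps b (insert i J)) (t - b j * l))"
    using nth_eq_sum_if_one_minus_X_power_mult[OF bj] by blast
  also have "\<bar>\<dots>\<bar> \<le> (\<Sum>l\<le>t div b j. real (t + 1) ^ card J)"
  proof (rule order_trans[OF sum_abs], rule sum_mono)
    fix l
    have "\<bar>fps_nth (rep_fps b (insert i J)) (t - b j * l)\<bar> \<le> real (t - b j * l + 1) ^ card J"
      using insert.IH[of i] insert.hyps(2) insert.prems(2) by blast
    also have "\<dots> \<le> real (t + 1) ^ card J" by (intro power_mono) auto
    finally show "\<bar>fps_nth (rep_fps b (insert i J)) (t - b j * l)\<bar> \<le> real (t + 1) ^ card J" .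
  qed
  also have "\<dots> = real (t div b j + 1) * real (t + 1) ^ card J" by simp
  also have "\<dots> \<le> real (t + 1) * real (t + 1) ^ card J"
    by (intro mult_right_mono) auto
  finally show ?case using insert.hyps by simp
qed

lemma rep_fps_small:
  assumes "finite J" and "\<And>i. i \<in> J \<Longrightarrow> b i > 0"
  shows "rep_fps b J \<in> small_fps (card J)"
proof (cases "J = {}")
  case True
  \<comment> \<open>With no entries the series is 1, whose coefficients vanish eventually and so are
    \<open>o(1)\<close>. This case arises when two of two entries are removed.\<close>
  have "eventually (\<lambda>t. fps_nth (1 :: real fps) t = 0) sequentially"
    using eventually_gt_at_top[of "0 :: nat"] by eventually_elim simp
  then have "fps_nth (1 :: real fps) \<in> o(\<lambda>t. 1)"
    by (simp add: landau_o.small.in_cong)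
  then show ?thesis using True by (simp add: small_fps_def rep_fps_def)
next
  case False
  then obtain j where j: "j \<in> J" by auto
  define k where "k = card (J - {j})"
  have card: "card J = Suc k" unfolding k_def using j assms(1) by (metis card_Suc_Diff1)
  have "fps_nth (rep_fps b J) \<in> o(\<lambda>t. real t ^ Suc k)"
  proof (rule landau_o.smallI)
    fix c :: real assume c: "c > 0"
    \<comment> \<open>The factor \<open>2 ^ k\<close> comes from \<open>t + 1 \<le> 2 * t\<close>;
      one spare power of \<open>t\<close> absorbs it.\<close>
    obtain T :: nat where T: "real T \<ge> 2 ^ k / c" using real_arch_simple by blast
    have "norm (fps_nth (rep_fps b J) t) \<le> c * norm (real t ^ Suc k)" if "t \<ge> T + 1" for t
    proof -
      have "\<bar>fps_nth (rep_fps b J) t\<bar> \<le> real (t + 1) ^ k"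
        using rep_fps_upper_bound[of "J - {j}" j b t] assms j by (simp add: insert_absorb k_def)
      also have "\<dots> \<le> (2 * real t) ^ k" using that by (intro power_mono) auto
      also have "\<dots> = 2 ^ k * real t ^ k" by (simp add: power_mult_distrib)
      also have "\<dots> \<le> c * real t * real t ^ k"
      proof (rule mult_right_mono)
        have "2 ^ k / c \<le> real t" using T that by linarith
        then show "2 ^ k \<le> c * real t" using c by (simp add: field_simps)
      qed simp
      finally show ?thesis by simp
    qed
    then show "eventually (\<lambda>t. norm (fps_nth (rep_fps b J) t) \<le> c * norm (real t ^ Suc k)) sequentially"
      unfolding eventually_sequentially by blast
  qed
  then show ?thesis by (simp add: small_fps_def card)
qed

text \<open>Here \<open>u\<close> is the series of partial sums, counting representations of numbers
  up to \<open>t\<close>. A new entry \<open>b j\<close> sums earlier values at distances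
  \<open>b j\<close>; about \<open>t / (2 * b j)\<close> of them sit at indices at least
  \<open>t / 2\<close>, which gains one power of \<open>t\<close>.\<close>

lemma cumulative_rep_fps_lower_bound:
  assumes "finite J" and "\<And>i. i \<in> J \<Longrightarrow> b i > 0"
  shows "\<exists>c>0. \<forall>u t. (1 - fps_X) * u = rep_fps b J \<longrightarrow> fps_nth u t \<ge> c * real t ^ card J"
  using assms
proof (induction J rule: finite_induct)
  case empty
  have "fps_nth u t \<ge> 1 * real t ^ card {}" if u: "(1 - fps_X) * u = rep_fps b {}" for u t
  proof -
    have "fps_nth u t = (\<Sum>j\<le>t. fps_nth 1 (t - j))"
      using nth_eq_sum_if_one_minus_X_power_mult[of 1 u 1 t] u by (simp add: rep_fps_def)
    also have "\<dots> \<ge> (\<Sum>j\<in>{t}. fps_nth 1 (t - j))"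
      by (rule sum_mono2) auto
    finally show ?thesis by simp
  qed
  then show ?case by (intro exI[of _ 1]) auto
next
  case (insert j J)
  then obtain c where c: "c > 0"
    "\<And>u t. (1 - fps_X) * u = rep_fps b J \<Longrightarrow> fps_nth u t \<ge> c * real t ^ card J" by auto
  define k where "k = card J"
  \<comment> \<open>\<open>2 ^ k\<close> pays for replacing \<open>t\<close> by
    \<open>t / 2\<close>, and \<open>2 * b j\<close> for the number of summands kept.\<close>
  define c' where "c' = c / (2 ^ k * (2 * real (b j)))"
  have bj: "b j > 0" using insert by simp
  have "c' > 0" using c(1) bj by (simp add: c'_def)
  moreover have "fps_nth u t \<ge> c' * real t ^ Suc k"
    if u: "(1 - fps_X) * u = rep_fps b (insert j J)" for u t
  proof -
    define v where "v = (1 - fps_X ^ b j) * u"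
    have "(1 - fps_X) * v = (1 - fps_X ^ b j) * ((1 - fps_X) * u)"
      unfolding v_def by (simp only: mult_ac)
    also have "\<dots> = rep_fps b J"
      unfolding u using rep_fps_remove[of "insert j J" j b] insert.hyps bj by simp
    finally have v: "fps_nth v t \<ge> c * real t ^ k" for t using c(2) k_def by blast
    have v0: "fps_nth v t \<ge> 0" for t
      using v[of t] c(1) by (meson mult_nonneg_nonneg less_imp_le of_nat_0_le_iff order_trans zero_le_power)
    \<comment> \<open>The summands \<open>i \<le> m\<close> have index at least
      \<open>t / 2\<close>, and there are \<open>m + 1\<close> of them, at least
      \<open>t / (2 * b j)\<close>.\<close>
    define m where "m = t div (2 * b j)"
    have bm: "2 * (b j * m) \<le> t"
      unfolding m_def using div_times_less_eq_dividend[of t "2 * b j"] by (simp add: mult_ac)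
    have "t < 2 * b j * (m + 1)"
      unfolding m_def using bj dividend_less_times_div[of "2 * b j" t] by (simp add: algebra_simps)
    then have "real t < real (2 * b j * (m + 1))" by (simp only: of_nat_less_iff)
    then have m: "real t / (2 * real (b j)) \<le> real (m + 1)"
      using bj by (simp add: field_simps)
    have "c' * real t ^ Suc k = real t / (2 * real (b j)) * (c * (real t / 2) ^ k)"
      by (simp add: c'_def power_divide mult_ac)
    also have "\<dots> \<le> real (m + 1) * (c * (real t / 2) ^ k)"
      using m c(1) by (intro mult_right_mono) auto
    also have "\<dots> = (\<Sum>i\<le>m. c * (real t / 2) ^ k)" by simp
    also have "\<dots> \<le> (\<Sum>i\<le>m. fps_nth v (t - b j * i))"
    proof (rule sum_mono)
      fix i assume i: "i \<in> {..m}"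
      have "b j * i \<le> b j * m" using i by simp
      then have "real t / 2 \<le> real (t - b j * i)" using bm by linarith
      then have "c * (real t / 2) ^ k \<le> c * real (t - b j * i) ^ k"
        using c(1) by (intro mult_left_mono power_mono) auto
      then show "c * (real t / 2) ^ k \<le> fps_nth v (t - b j * i)" using v order_trans by blast
    qed
    also have "\<dots> \<le> (\<Sum>i\<le>t div b j. fps_nth v (t - b j * i))"
    proof (rule sum_mono2)
      have "m \<le> t div b j" unfolding m_def using bj by (intro div_le_mono2) auto
      then show "{..m} \<subseteq> {..t div b j}" by auto
    qed (use v0 in auto)
    also have "\<dots> = fps_nth u t"
      using nth_eq_sum_if_one_minus_X_power_mult[OF bj, of u v t] v_def by simp
    finally show ?thesis .
  qed
  ultimately show ?case using insert.hyps k_def by auto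
qed

text \<open>
  A root of unity other than 1 is a pole of order at most \<open>card J - 2\<close> of the generating function;
  the closure of \<open>small_fps\<close> under the Euclidean algorithm expresses this without roots of unity.
\<close>

lemma rep_fps_second_difference_small:
  assumes "finite J" and pos: "\<And>i. i \<in> J \<Longrightarrow> b i > 0" and "card J \<ge> 2"
    and Gcd: "\<And>i. i \<in> J \<Longrightarrow> Gcd (b ` (J - {i})) = 1"
  shows "(1 - fps_X) * ((1 - fps_X) * rep_fps b J) \<in> small_fps (card J - 2)"
proof -
  \<comment> \<open>Two passages to the gcd: with \<open>i\<close> fixed, the other entries have gcd
    1 and yield one factor \<open>1 - fps_X\<close>; afterwards \<open>i\<close> varies over all
    entries and yields the second.\<close>
  have *: "(1 - fps_X ^ b i) * ((1 - fps_X) * rep_fps b J) \<in> small_fps (card J - 2)"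
    if i: "i \<in> J" for i
  proof -
    have "(1 - fps_X ^ Gcd (b ` (J - {i}))) * ((1 - fps_X ^ b i) * rep_fps b J) \<in> small_fps (card J - 2)"
    proof (rule small_fps_Gcd)
      fix m assume "m \<in> b ` (J - {i})"
      then obtain j where j: "m = b j" "j \<in> J" "j \<noteq> i" by auto
      have "(1 - fps_X ^ m) * ((1 - fps_X ^ b i) * rep_fps b J) = rep_fps b (J - {i} - {j})"
        using rep_fps_remove[of J i b] rep_fps_remove[of "J - {i}" j b] i j assms(1) pos by simp
      moreover have "card (J - {i} - {j}) = card J - 2"
        using i j assms(1) by (simp add: card_Diff_singleton_if)
      ultimately show "(1 - fps_X ^ m) * ((1 - fps_X ^ b i) * rep_fps b J) \<in> small_fps (card J - 2)"
        using rep_fps_small[of "J - {i} - {j}" b] assms(1) pos by auto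
    qed (use assms in simp)
    then show ?thesis using Gcd[OF i] by (simp add: mult_ac)
  qed
  have "Gcd (b ` J) = 1"
  proof -
    obtain i where i: "i \<in> J" using assms(3) by fastforce
    then have "Gcd (b ` J) dvd Gcd (b ` (J - {i}))"
      by (intro Gcd_greatest Gcd_dvd) auto
    then show ?thesis using Gcd[OF i] by simp
  qed
  then show ?thesis
    using small_fps_Gcd[of "b ` J" "(1 - fps_X) * rep_fps b J" "card J - 2"] * assms(1) by auto
qed

lemma rep_fps_eventually_strict_increasing:
  assumes J: "finite J" and pos: "\<And>i. i \<in> J \<Longrightarrow> b i > 0" and "card J \<ge> 2"
    and Gcd: "\<And>i. i \<in> J \<Longrightarrow> Gcd (b ` (J - {i})) = 1"
  shows "eventually (\<lambda>t. fps_nth (rep_fps b J) t < fps_nth (rep_fps b J) (Suc t)) sequentially"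
proof -
  define k where "k = card J - 2"
  define D where "D = (1 - fps_X) * rep_fps b J"
  \<comment> \<open>Slow variation over any fixed distance, by telescoping from distance 1.\<close>
  have D: "(1 - fps_X ^ m) * D \<in> small_fps k" for m
  proof (induction m)
    case (Suc m)
    have "(1 - fps_X ^ Suc m) * D = (1 - fps_X ^ m) * D + fps_X ^ m * ((1 - fps_X) * D)"
      by (simp add: algebra_simps)
    moreover have "(1 - fps_X) * D \<in> small_fps k"
      unfolding D_def k_def using rep_fps_second_difference_small assms by blast
    ultimately show ?case using Suc by (simp only: small_fps_add small_fps_X_power_mult)
  qed (simp add: small_fps_0)
  obtain i where i: "i \<in> J" using assms(3) by fastforce
  have "card (J - {i}) \<noteq> 0" using i assms(3) by simp
  then obtain j where j: "j \<in> J" "j \<noteq> i"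
    by (metis DiffE all_not_in_conv card.empty insertI1)
  have card: "card (J - {i} - {j}) = k"
    unfolding k_def using i j J by (simp add: card_Diff_singleton_if)
  \<comment> \<open>\<open>w\<close> sums \<open>D\<close> over windows of lengths
    \<open>b i\<close> and \<open>b j\<close>. The two geometric sums turn the two factors
    \<open>1 - fps_X\<close> into those that delete the entries \<open>i\<close> and
    \<open>j\<close>.\<close>
  define w where "w = (\<Sum>l<b i. fps_X ^ l) * ((\<Sum>m<b j. fps_X ^ m) * D)"
  have geo: "(1 - fps_X) * (\<Sum>l<m. fps_X ^ l) = (1 - fps_X ^ m :: real fps)" for m
    by (simp add: one_diff_power_eq)
  have "(1 - fps_X) * ((1 - fps_X) * w)
      = (1 - fps_X) * (\<Sum>l<b i. fps_X ^ l) * ((1 - fps_X) * (\<Sum>m<b j. fps_X ^ m) * D)"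
    unfolding w_def by (simp only: mult_ac)
  also have "\<dots> = (1 - fps_X) * ((1 - fps_X ^ b j) * ((1 - fps_X ^ b i) * rep_fps b J))"
    unfolding geo D_def by (simp only: mult_ac)
  also have "\<dots> = (1 - fps_X) * rep_fps b (J - {i} - {j})"
    using rep_fps_remove[of J i b] rep_fps_remove[of "J - {i}" j b] i j J pos by simp
  finally have "(1 - fps_X) * w = rep_fps b (J - {i} - {j})"
    using one_minus_X_power_neq_0[of 1] by simp
  then obtain c where c: "c > 0" "\<And>t. fps_nth w t \<ge> c * real t ^ k"
    using cumulative_rep_fps_lower_bound[of "J - {i} - {j}" b] J pos card by auto
  \<comment> \<open>\<open>w\<close> consists of \<open>b i * b j\<close> shifted copies of
    \<open>D\<close>, each differing from \<open>D\<close> by a small series. So the lower bound for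
    \<open>w\<close> carries over to that multiple of \<open>D\<close>.\<close>
  have "(\<Sum>l<b i. \<Sum>m<b j. (1 - fps_X ^ (l + m)) * D) = of_nat (b i * b j) * D - w"
  proof -
    have "w = (\<Sum>l<b i. \<Sum>m<b j. fps_X ^ (l + m) * D)"
      unfolding w_def 
      by (subst sum.swap) (simp add: sum_distrib_left sum_distrib_right power_add mult.assoc)
    then show ?thesis by (simp add: left_diff_distrib sum_subtractf)
  qed
  moreover have "(\<Sum>l<b i. \<Sum>m<b j. (1 - fps_X ^ (l + m)) * D) \<in> small_fps k"
    by (intro small_fps_sum D)
  ultimately have "fps_nth (of_nat (b i * b j) * D - w) \<in> o(\<lambda>t. real t ^ k)"
    by (simp add: small_fps_def)
  from landau_o.smallD[OF this, of "c / 2"] c(1)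
  have "eventually (\<lambda>t. \<bar>fps_nth (of_nat (b i * b j) * D - w) t\<bar> \<le> c / 2 * real t ^ k) sequentially"
    by simp
  then have "eventually (\<lambda>t. fps_nth D t > 0) sequentially"
    using eventually_gt_at_top[of 0]
  proof eventually_elim
    case (elim t)
    have "fps_nth (of_nat (b i * b j) * D - w) t = real (b i * b j) * fps_nth D t - fps_nth w t"
      by (simp add: fps_of_nat[symmetric])
    moreover have "c * real t ^ k > 0" using c(1) elim by simp
    ultimately have "real (b i * b j) * fps_nth D t > 0" using elim c(2)[of t] by linarith
    then show ?case by (metis mult_nonneg_nonpos not_less of_nat_0_le_iff)
  qed
  \<comment> \<open>The coefficient of \<open>D\<close> at \<open>Suc t\<close> is the increment
    from \<open>t\<close> to \<open>Suc t\<close>.\<close>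
  then have "eventually (\<lambda>t. fps_nth D (Suc t) > 0) sequentially"
    by (simp only: eventually_sequentially_Suc[where P = "\<lambda>t. fps_nth D t > 0"])
  then show ?thesis
    by eventually_elim (simp add: D_def left_diff_distrib)
qed

section \<open>Counting solutions\<close>

definition solutions :: "nat list \<Rightarrow> nat \<Rightarrow> nat list set" where
  "solutions a t = {x. length x = length a \<and> (\<Sum>i<length a. a ! i * x ! i) = t}"

lemma nrep_eq_card_solutions: "nrep a t = card (solutions a t)"
  by (simp add: nrep_def solutions_def)

lemma finite_solutions:
  assumes "\<forall>i<length a. a ! i > 0"
  shows "finite (solutions a t)"
proof (rule finite_subset)
  show "solutions a t \<subseteq> {x. set x \<subseteq> {..t} \<and> length x = length a}"
  proof
    fix x assume x: "x \<in> solutions a t"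
    have "x ! i \<le> t" if i: "i < length a" for i
    proof -
      have "x ! i \<le> a ! i * x ! i" using assms i by (metis le_square mult_le_mono1 nat_mult_1 Suc_leI One_nat_def)
      also have "\<dots> \<le> (\<Sum>i<length a. a ! i * x ! i)"
        using i by (intro member_le_sum) auto
      also have "\<dots> = t" using x by (simp add: solutions_def)
      finally show ?thesis .
    qed
    then show "x \<in> {x. set x \<subseteq> {..t} \<and> length x = length a}"
      using x by (auto simp: solutions_def in_set_conv_nth)
  qed
qed (rule finite_lists_length_eq, simp)

text \<open>Solutions are split by their first coordinate: either it is 0, or lowering it by one
  gives a solution for \<open>t - b\<close>.\<close>

lemma nrep_Cons:
  assumes "b > 0" and "\<forall>i<length l. l ! i > 0"
  shows "nrep (b # l) t = nrep l t + (if t < b then 0 else nrep (b # l) (t - b))"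
proof -
  let ?inc = "\<lambda>x. Suc (hd x) # tl x"
  \<comment> \<open>For \<open>t < b\<close> the truncated \<open>t - b\<close> would be 0 and let
    in a spurious solution, hence the case distinction.\<close>
  define B where "B = (if t < b then {} else ?inc ` solutions (b # l) (t - b))"
  have fin: "finite (solutions (b # l) u)" for u
    using assms by (intro finite_solutions) (auto simp: nth_Cons split: nat.splits)
  have sol_Cons: "(y # ys) \<in> solutions (b # l) u
      \<longleftrightarrow> length ys = length l \<and> b * y + (\<Sum>i<length l. l ! i * ys ! i) = u" for y ys u
    unfolding solutions_def mem_Collect_eq list.size add_0_right add_Suc_right sum.lessThan_Suc_shift
    by auto
  have ne: "[] \<notin> solutions (b # l) u" for u by (simp add: solutions_def)
  have "solutions (b # l) t = (#) 0 ` solutions l t \<union> B"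
  proof (intro equalityI subsetI)
    fix x assume x: "x \<in> solutions (b # l) t"
    then obtain y ys where xy: "x = y # ys" using ne by (cases x) auto
    show "x \<in> (#) 0 ` solutions l t \<union> B"
    proof (cases y)
      case 0
      then show ?thesis using x xy by (auto simp: sol_Cons) (auto simp: solutions_def)
    next
      case (Suc z)
      have "t \<ge> b" "(z # ys) \<in> solutions (b # l) (t - b)"
        using x unfolding xy Suc sol_Cons by auto
      then show ?thesis unfolding B_def xy Suc by (auto intro!: image_eqI[of _ _ "z # ys"])
    qed
  next
    fix x assume "x \<in> (#) 0 ` solutions l t \<union> B"
    then show "x \<in> solutions (b # l) t"
    proof
      assume "x \<in> (#) 0 ` solutions l t"
      then show ?thesis by (auto simp: sol_Cons) (auto simp: solutions_def)
    next
      assume "x \<in> B"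
      then obtain z where z: "t \<ge> b" "x = ?inc z" "z \<in> solutions (b # l) (t - b)"
        unfolding B_def by (auto split: if_splits)
      then show ?thesis using ne by (cases z) (auto simp: sol_Cons)
    qed
  qed
  moreover have "card ((#) 0 ` solutions l t) = nrep l t"
    by (simp add: nrep_eq_card_solutions card_image)
  moreover have "card B = (if t < b then 0 else nrep (b # l) (t - b))"
  proof -
    have "inj_on ?inc (solutions (b # l) (t - b))"
      by (rule inj_onI) (metis ne list.collapse list.inject nat.inject)
    then show ?thesis by (simp add: B_def nrep_eq_card_solutions card_image)
  qed
  moreover have "card ((#) 0 ` solutions l t \<union> B) = card ((#) 0 ` solutions l t) + card B"
    by (rule card_Un_disjoint) (use finite_solutions[OF assms(2)] fin in \<open>auto simp: B_def\<close>)
  ultimately show ?thesis by (simp add: nrep_eq_card_solutions)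
qed

text \<open>In generating functions \<open>nrep_Cons\<close> says that multiplication by
  \<open>1 - fps_X ^ b\<close> removes the entry \<open>b\<close>; this nonzero factor can be
  cancelled.\<close>

lemma nrep_eq_rep_fps:
  assumes "\<forall>i<length l. l ! i > 0"
  shows "real (nrep l t) = fps_nth (rep_fps ((!) l) {..<length l}) t"
proof -
  have "Abs_fps (\<lambda>t. real (nrep l t)) = rep_fps ((!) l) {..<length l}"
    using assms
  proof (induction l)
    case Nil
    have "{x :: nat list. x = [] \<and> 0 = t} = (if t = 0 then {[]} else {})" for t :: nat by auto
    then show ?case by (intro fps_ext) (auto simp: nrep_def rep_fps_def)
  next
    case (Cons b l)
    have b: "b > 0" and l: "\<forall>i<length l. l ! i > 0" using Cons.prems by (auto simp: nth_Cons')
    have "(1 - fps_X ^ b) * Abs_fps (\<lambda>t. real (nrep (b # l) t)) = Abs_fps (\<lambda>t. real (nrep l t))"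
      by (rule fps_ext) (simp add: left_diff_distrib fps_X_power_mult_nth nrep_Cons[OF b l])
    also have "\<dots> = (1 - fps_X ^ b) * rep_fps ((!) (b # l)) {..<length (b # l)}"
    proof -
      have "rep_fps ((!) (b # l)) {..<length (b # l)} = inverse (1 - fps_X ^ b) * rep_fps ((!) l) {..<length l}"
        unfolding rep_fps_def list.size add_0_right add_Suc_right prod.lessThan_Suc_shift fps_inverse_mult
        by simp
      moreover have "(1 - fps_X ^ b) * inverse (1 - fps_X ^ b :: real fps) = 1"
        using b by (intro inverse_mult_eq_1') simp
      ultimately show ?thesis
        unfolding Cons.IH[OF l] by (simp only: mult.assoc[symmetric] mult_1)
    qed
    finally show ?case using one_minus_X_power_neq_0[OF b] by simp
  qed
  then show ?thesis by (metis fps_nth_Abs_fps)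
qed

text \<open>An integer sequence that increases strictly from \<open>T\<close> on is unbounded, so it
  finally exceeds its finitely many early values as well.\<close>

lemma eventually_strict_record:
  fixes f :: "nat \<Rightarrow> nat"
  assumes "eventually (\<lambda>t. f t < f (Suc t)) sequentially"
  shows "eventually (\<lambda>s. f s > 0 \<and> (\<forall>q<s. f q < f s) \<and> (\<forall>q>s. f q > f s)) sequentially"
proof -
  obtain T where T: "\<And>t. t \<ge> T \<Longrightarrow> f t < f (Suc t)"
    using assms by (auto simp: eventually_sequentially)
  have mono: "f x < f y" if "T \<le> x" "x < y" for x y
    using that(2,1) by (induction x y rule: less_Suc_induct) (auto intro: T)
  have grow: "f (T + j) \<ge> j" for j
  proof (induction j)
    case (Suc j)
    then show ?case using T[of "T + j"] by simp
  qed simp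
  define M where "M = Max (f ` {..T})"
  have M: "f q \<le> M" if "q \<le> T" for q unfolding M_def using that by (intro Max_ge) auto
  \<comment> \<open>The threshold forces \<open>f s \<ge> s - T > M\<close>, where \<open>M\<close>
    bounds all values up to \<open>T\<close>.\<close>
  have "f s > 0 \<and> (\<forall>q<s. f q < f s) \<and> (\<forall>q>s. f q > f s)" if s: "s \<ge> T + M + 1" for s
  proof -
    have fs: "f s > M" using grow[of "s - T"] s by simp
    have "f q < f s" if "q < s" for q
      using M[of q] fs mono[of q s] that by (cases "q \<le> T") auto
    moreover have "f q > f s" if "q > s" for q using mono[of s q] s that by simp
    ultimately show ?thesis using fs by auto
  qed
  then show ?thesis unfolding eventually_sequentially by blast
qed

section \<open>Preliminaries on divisibility and on deleting a list entry\<close>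

lemma prod_dvd_if_pairwise_coprime:
  fixes d :: "'i \<Rightarrow> nat"
  assumes "finite I" and "\<And>i. i \<in> I \<Longrightarrow> d i dvd m"
    and "\<And>i j. i \<in> I \<Longrightarrow> j \<in> I \<Longrightarrow> i \<noteq> j \<Longrightarrow> coprime (d i) (d j)"
  shows "(\<Prod>i\<in>I. d i) dvd m"
  using assms
proof (induction I rule: finite_induct)
  case (insert i I)
  have "coprime (d i) (\<Prod>j\<in>I. d j)"
    using insert.hyps insert.prems(2) by (intro prod_coprime_right) auto
  moreover have "d i dvd m" "(\<Prod>j\<in>I. d j) dvd m" using insert by auto
  ultimately show ?case using insert.hyps by (simp add: divides_mult)
qed simp

lemma set_omit:
  assumes "i < length a"
  shows "set (omit i a) = (!) a ` ({..<length a} - {i})"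
proof -
  have "set (take i a) = (!) a ` {..<i}"
    using assms by (simp add: nth_image[symmetric] lessThan_atLeast0)
  moreover have "set (drop (Suc i) a) = (!) a ` {Suc i..<length a}"
  proof -
    have "set (drop (Suc i) a) = (\<lambda>j. a ! (j + Suc i)) ` {0..<length a - Suc i}"
      by (force simp: set_conv_nth add.commute)
    also have "\<dots> = (!) a ` (\<lambda>j. j + Suc i) ` {0..<length a - Suc i}"
      by (simp only: image_image)
    also have "(\<lambda>j. j + Suc i) ` {0..<length a - Suc i} = {Suc i..<length a}"
      using assms by (simp only: image_add_atLeastLessThan') auto
    finally show ?thesis .
  qed
  moreover have "{..<length a} - {i} = {..<i} \<union> {Suc i..<length a}" using assms by auto
  ultimately show ?thesis by (simp add: omit_def image_Un)
qed

section \<open>Reduction modulo the product of the gcds\<close>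

locale coprime_vector =
  fixes a :: "nat list" and n p :: nat and d :: "nat \<Rightarrow> nat"
  assumes len: "length a = n" and n_ge_2: "n \<ge> 2"
    and pos: "\<And>i. i < n \<Longrightarrow> a ! i > 0"
    and Gcd_a: "Gcd (set a) = 1"
    and d_def: "\<And>i. i < n \<Longrightarrow> d i = Gcd (set (omit i a))"
    and p_def: "p = (\<Prod>i<n. d i)"
begin

section \<open>Arithmetic of the gcds and the reduced vector\<close>

lemma dvd_d_iff:
  assumes "i < n"
  shows "m dvd d i \<longleftrightarrow> (\<forall>j<n. j \<noteq> i \<longrightarrow> m dvd a ! j)"
proof -
  have "d i = Gcd ((!) a ` ({..<n} - {i}))" using set_omit[of i a] len d_def[OF assms] assms by simp
  then have "m dvd d i \<longleftrightarrow> (\<forall>x\<in>(!) a ` ({..<n} - {i}). m dvd x)" by (simp only: dvd_Gcd_iff)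
  then show ?thesis by blast
qed

lemma d_dvd: "i < n \<Longrightarrow> j < n \<Longrightarrow> j \<noteq> i \<Longrightarrow> d i dvd a ! j"
  using dvd_d_iff[of i "d i"] by simp

lemma d_pos: assumes "i < n" shows "d i > 0"
proof -
  obtain j where j: "j < n" "j \<noteq> i"
    using n_ge_2 that[of 0] that[of 1] by (cases "i = 0") auto
  show ?thesis using dvd_pos_nat[OF pos[OF j(1)] d_dvd[OF assms j]] .
qed

lemma p_pos: "p > 0"
  unfolding p_def by (rule prod_pos) (use d_pos in blast)

text \<open>A common divisor would divide every entry, and the entries have gcd 1.\<close>

lemma coprime_d_a: assumes "i < n" shows "coprime (d i) (a ! i)"
proof (rule coprimeI)
  fix m assume m: "m dvd d i" "m dvd a ! i"
  have "m dvd x" if "x \<in> set a" for x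
  proof -
    obtain j where "j < n" "x = a ! j" using \<open>x \<in> set a\<close> len by (metis in_set_conv_nth)
    then show ?thesis using m dvd_d_iff[OF assms, of m] by (cases "j = i") blast+
  qed
  then have "m dvd Gcd (set a)" by (intro Gcd_greatest)
  then show "is_unit m" unfolding Gcd_a .
qed

text \<open>\<open>d j\<close> divides \<open>a ! i\<close>, which is coprime to
  \<open>d i\<close>.\<close>

lemma coprime_d_d: "i < n \<Longrightarrow> j < n \<Longrightarrow> i \<noteq> j \<Longrightarrow> coprime (d i) (d j)"
  by (rule coprime_divisors[OF dvd_refl d_dvd coprime_d_a])

text \<open>These are the \<open>b i\<close> of the overview. The division is exact, as the divisors
  \<open>d j\<close> are pairwise coprime and each divides \<open>a ! i\<close>.\<close>

definition reduced :: "nat \<Rightarrow> nat" where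
  "reduced i = a ! i div (\<Prod>j\<in>{..<n} - {i}. d j)"

lemma reduced_mult: assumes "i < n" shows "a ! i = reduced i * (\<Prod>j\<in>{..<n} - {i}. d j)"
proof -
  have "(\<Prod>j\<in>{..<n} - {i}. d j) dvd a ! i"
    by (rule prod_dvd_if_pairwise_coprime) (use assms d_dvd coprime_d_d in blast)+
  then show ?thesis by (simp add: reduced_def)
qed

lemma d_mult_a: assumes "i < n" shows "d i * a ! i = p * reduced i"
proof -
  have "p = d i * (\<Prod>j\<in>{..<n} - {i}. d j)"
    unfolding p_def using assms by (intro prod.remove) auto
  then have "p * reduced i = d i * (reduced i * (\<Prod>j\<in>{..<n} - {i}. d j))" by (simp only: mult_ac)
  then show ?thesis by (simp only: reduced_mult[OF assms, symmetric])
qed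

lemma reduced_pos: assumes "i < n" shows "reduced i > 0"
proof (rule ccontr)
  assume "\<not> reduced i > 0"
  then have "a ! i = 0" by (subst reduced_mult[OF assms]) simp
  then show False using pos[OF assms] by simp
qed

text \<open>Every entry other than \<open>a ! i\<close> still contains the factor \<open>d i\<close>
  beside its reduced entry, so a common divisor \<open>m\<close> of those reduced entries makes
  \<open>m * d i\<close> divide \<open>d i\<close>.\<close>

lemma Gcd_reduced: assumes i: "i < n" shows "Gcd (reduced ` ({..<n} - {i})) = 1"
proof -
  define m where "m = Gcd (reduced ` ({..<n} - {i}))"
  have "m * d i dvd a ! j" if j: "j < n" "j \<noteq> i" for j
  proof -
    have "m dvd reduced j" unfolding m_def using j by (intro Gcd_dvd) auto
    moreover have "d i dvd (\<Prod>l\<in>{..<n} - {j}. d l)" using i j by (intro dvd_prodI) auto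
    ultimately show ?thesis by (subst reduced_mult[OF j(1)]) (rule mult_dvd_mono)
  qed
  then have "m * d i dvd d i" using dvd_d_iff[OF i] by blast
  then have "m = 1" using d_pos[OF i] by simp
  then show ?thesis unfolding m_def .
qed

lemma nrep_reduced_eq_rep_fps:
  "real (nrep (map reduced [0..<n]) t) = fps_nth (rep_fps reduced {..<n}) t"
proof -
  have "map reduced [0..<n] ! i > 0" if "i < length (map reduced [0..<n])" for i
    using that reduced_pos[of i] by simp
  then have "real (nrep (map reduced [0..<n]) t)
      = fps_nth (rep_fps ((!) (map reduced [0..<n])) {..<length (map reduced [0..<n])}) t"
    by (intro nrep_eq_rep_fps) blast
  also have "rep_fps ((!) (map reduced [0..<n])) {..<length (map reduced [0..<n])}
      = rep_fps reduced {..<n}"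
    unfolding rep_fps_def by (intro arg_cong[where f = inverse] prod.cong) auto
  finally show ?thesis .
qed

lemma nrep_reduced_eventually_strict_increasing:
  "eventually (\<lambda>t. nrep (map reduced [0..<n]) t < nrep (map reduced [0..<n]) (Suc t)) sequentially"
proof -
  have "eventually (\<lambda>t. fps_nth (rep_fps reduced {..<n}) t
      < fps_nth (rep_fps reduced {..<n}) (Suc t)) sequentially"
  proof (rule rep_fps_eventually_strict_increasing)
    show "card {..<n} \<ge> 2" using n_ge_2 by simp
    show "reduced i > 0" if "i \<in> {..<n}" for i using that reduced_pos by blast
    show "Gcd (reduced ` ({..<n} - {i})) = 1" if "i \<in> {..<n}" for i using that Gcd_reduced by blast
  qed simp
  then show ?thesis unfolding nrep_reduced_eq_rep_fps[symmetric] of_nat_less_iff .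
qed

section \<open>Digit vectors as representatives of the residues modulo \<open>p\<close>\<close>

lemma cong_component:
  fixes x y :: "nat \<Rightarrow> nat"
  assumes i: "i < n" and "[(\<Sum>j<n. a ! j * x j) = (\<Sum>j<n. a ! j * y j)] (mod p)"
  shows "[x i = y i] (mod d i)"
proof -
  \<comment> \<open>Modulo \<open>d i\<close> only the term of index \<open>i\<close> survives, and
    there \<open>a ! i\<close> can be cancelled.\<close>
  have *: "[(\<Sum>j<n. a ! j * z j) = a ! i * z i] (mod d i)" for z :: "nat \<Rightarrow> nat"
  proof -
    have "d i dvd (\<Sum>j\<in>{..<n} - {i}. a ! j * z j)"
      using d_dvd[OF i] by (intro dvd_sum) auto
    then have "[a ! i * z i + (\<Sum>j\<in>{..<n} - {i}. a ! j * z j) = a ! i * z i + 0] (mod d i)"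
      by (intro cong_add cong_refl) (simp add: cong_0_iff)
    then show ?thesis using i by (simp add: sum.remove[of "{..<n}" i])
  qed
  have "d i dvd p" unfolding p_def using i by (intro dvd_prodI) auto
  then have "[(\<Sum>j<n. a ! j * x j) = (\<Sum>j<n. a ! j * y j)] (mod d i)"
    using assms(2) cong_dvd_modulus_nat by blast
  then have "[a ! i * x i = a ! i * y i] (mod d i)"
    using * cong_trans cong_sym by meson
  then show ?thesis
    using coprime_d_a[OF i] by (simp add: cong_mult_lcancel_nat coprime_commute)
qed

text \<open>Extensional functions are fixed by their values below \<open>n\<close>, so that there
  are exactly \<open>p\<close> of them.\<close>

definition digits :: "(nat \<Rightarrow> nat) set" where
  "digits = (\<Pi>\<^sub>E i\<in>{..<n}. {..<d i})"

text \<open>A representative of a residue class modulo \<open>p\<close>; it may exceed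
  \<open>p\<close>.\<close>

definition rem :: "(nat \<Rightarrow> nat) \<Rightarrow> nat" where
  "rem r = (\<Sum>i<n. a ! i * r i)"

lemma digits_less: "r \<in> digits \<Longrightarrow> i < n \<Longrightarrow> r i < d i"
  by (auto simp: digits_def)

lemma finite_digits: "finite digits"
  unfolding digits_def by (intro finite_PiE) auto

lemma card_digits: "card digits = p"
  unfolding digits_def p_def by (simp add: card_PiE)

lemma digits_eq_if_rem_cong:
  assumes "r \<in> digits" "r' \<in> digits" "[rem r = rem r'] (mod p)"
  shows "r = r'"
proof (rule PiE_ext)
  fix i assume i: "i \<in> {..<n}"
  then have "[r i = r' i] (mod d i)"
    using assms(3) cong_component[of i r r'] by (simp add: rem_def)
  then show "r i = r' i"
    using digits_less[OF assms(1)] digits_less[OF assms(2)] i cong_less_modulus_unique_nat by blast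
qed (use assms digits_def in auto)

text \<open>Pigeonhole: the \<open>p\<close> digit vectors have distinct residues modulo
  \<open>p\<close>.\<close>

lemma ex_rem_cong: "\<exists>r\<in>digits. [rem r = t] (mod p)"
proof -
  have inj: "inj_on (\<lambda>r. rem r mod p) digits"
    by (rule inj_onI) (simp add: digits_eq_if_rem_cong cong_def)
  have "(\<lambda>r. rem r mod p) ` digits = {..<p}"
    by (rule card_subset_eq) (use p_pos card_image[OF inj] card_digits in auto)
  then have "t mod p \<in> (\<lambda>r. rem r mod p) ` digits" using p_pos by simp
  then show ?thesis unfolding cong_def by (metis (mono_tags, lifting) image_iff)
qed

lemma component_decomposition:
  assumes "r \<in> digits" "[(\<Sum>j<n. a ! j * x j) = rem r] (mod p)" "i < n"
  obtains y where "x i = r i + d i * y"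
proof -
  have c: "[x i = r i] (mod d i)"
    using cong_component[OF assms(3), of x r] assms(2) by (simp add: rem_def)
  have "x i mod d i = r i"
    using c digits_less[OF assms(1,3)] by (simp add: cong_def)
  then show ?thesis using that[of "x i div d i"] by (metis mod_mult_div_eq)
qed

text \<open>In any solution each \<open>x ! i\<close> is at least its residue \<open>r i\<close>, so
  the total is at least \<open>rem r\<close>.\<close>

lemma nrep_eq_0_if_less_rem:
  assumes "r \<in> digits" "[t = rem r] (mod p)" "t < rem r"
  shows "nrep a t = 0"
proof -
  have "solutions a t = {}"
  proof (rule ccontr)
    assume "solutions a t \<noteq> {}"
    then obtain x where x: "(\<Sum>i<n. a ! i * x ! i) = t"
      using len by (auto simp: solutions_def)
    have "r i \<le> x ! i" if "i < n" for i
      using component_decomposition[OF assms(1), of "\<lambda>i. x ! i" i] assms(2) x that by (metis le_add1)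
    then have "rem r \<le> t" unfolding rem_def x[symmetric] by (intro sum_mono mult_left_mono) auto
    then show False using assms(3) by simp
  qed
  then show ?thesis by (simp add: nrep_eq_card_solutions)
qed

text \<open>The bijection writes \<open>x ! i\<close> as \<open>r i + d i * y ! i\<close>. Since
  \<open>d i * a ! i = p * reduced i\<close>, the digits account for \<open>rem r\<close> and the
  \<open>y\<close> part for \<open>p * q\<close>.\<close>

lemma nrep_rem_add:
  assumes r: "r \<in> digits"
  shows "nrep a (rem r + p * q) = nrep (map reduced [0..<n]) q"
proof -
  let ?h = "\<lambda>y. map (\<lambda>i. r i + d i * y ! i) [0..<n]"
  have eval: "(\<Sum>i<n. a ! i * (r i + d i * z i)) = rem r + p * (\<Sum>i<n. reduced i * z i)"
    for z :: "nat \<Rightarrow> nat"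
  proof -
    have "a ! i * (r i + d i * z i) = a ! i * r i + p * (reduced i * z i)" if "i < n" for i
      using d_mult_a[OF that] by (simp only: distrib_left mult.assoc[symmetric]) (simp only: mult.commute)
    then show ?thesis by (simp add: rem_def sum.distrib sum_distrib_left)
  qed
  have sol: "y \<in> solutions (map reduced [0..<n]) q
      \<longleftrightarrow> length y = n \<and> (\<Sum>i<n. reduced i * y ! i) = q" for y
    by (auto simp: solutions_def)
  have "bij_betw ?h (solutions (map reduced [0..<n]) q) (solutions a (rem r + p * q))"
  proof (rule bij_betw_imageI)
    show "inj_on ?h (solutions (map reduced [0..<n]) q)"
    proof (rule inj_onI)
      fix y z assume *: "y \<in> solutions (map reduced [0..<n]) q"
        "z \<in> solutions (map reduced [0..<n]) q" "?h y = ?h z"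
      have "y ! i = z ! i" if "i < n" for i
        using *(3) that d_pos[OF that] by force
      then show "y = z" using * by (intro nth_equalityI) (auto simp: sol)
    qed
    show "?h ` solutions (map reduced [0..<n]) q = solutions a (rem r + p * q)"
    proof (intro equalityI subsetI)
      fix x assume "x \<in> ?h ` solutions (map reduced [0..<n]) q"
      then obtain y where y: "x = ?h y" "y \<in> solutions (map reduced [0..<n]) q" by (rule imageE)
      then have q: "(\<Sum>i<n. reduced i * y ! i) = q" by (simp only: sol)
      have "(\<Sum>i<n. a ! i * x ! i) = (\<Sum>i<n. a ! i * (r i + d i * y ! i))"
        using y(1) by (intro sum.cong) auto
      then show "x \<in> solutions a (rem r + p * q)"
        using y(1) q len eval[of "\<lambda>i. y ! i"] by (simp add: solutions_def)
    next
      fix x assume "x \<in> solutions a (rem r + p * q)"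
      then have x: "length x = n" "(\<Sum>i<n. a ! i * x ! i) = rem r + p * q"
        using len by (auto simp: solutions_def)
      then have "[(\<Sum>i<n. a ! i * x ! i) = rem r] (mod p)" by (simp add: cong_def)
      then have "\<exists>y. x ! i = r i + d i * y" if "i < n" for i
        using component_decomposition[OF r, of "\<lambda>i. x ! i" i] that by blast
      then obtain z where z: "\<And>i. i < n \<Longrightarrow> x ! i = r i + d i * z i" by metis
      have "rem r + p * q = rem r + p * (\<Sum>i<n. reduced i * z i)"
        using x(2) z eval[of z] by auto
      then have "(\<Sum>i<n. reduced i * z i) = q" using p_pos by simp
      then have "map z [0..<n] \<in> solutions (map reduced [0..<n]) q" by (simp add: sol)
      moreover have "x = ?h (map z [0..<n])" using x(1) z by (intro nth_equalityI) auto
      ultimately show "x \<in> ?h ` solutions (map reduced [0..<n]) q" by (rule rev_image_eqI)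
    qed
  qed
  from bij_betw_same_card[OF this] show ?thesis by (simp only: nrep_eq_card_solutions)
qed

text \<open>
  Every integer is uniquely \<open>e + p q\<close> with \<open>e \<in> rems\<close> and \<open>q\<close> an integer; \<open>gaps\<close> are the natural
  numbers for which \<open>q\<close> is negative.
\<close>

definition rems :: "nat set" where
  "rems = rem ` digits"

definition gaps :: "nat set" where
  "gaps = {t. \<forall>e\<in>rems. \<forall>q. t \<noteq> e + p * q}"

definition max_rem :: nat where
  "max_rem = (\<Sum>i<n. a ! i * (d i - 1))"

lemma inj_on_rem: "inj_on rem digits"
  by (rule inj_onI) (simp add: digits_eq_if_rem_cong)

lemma finite_rems: "finite rems"
  unfolding rems_def using finite_digits by simp

lemma card_rems: "card rems = p"
  unfolding rems_def using card_image[OF inj_on_rem] card_digits by simp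

lemma zero_in_rems: "0 \<in> rems"
proof -
  have "(\<lambda>i\<in>{..<n}. 0) \<in> digits" using d_pos by (auto simp: digits_def)
  moreover have "rem (\<lambda>i\<in>{..<n}. 0) = 0" by (simp add: rem_def)
  ultimately show ?thesis unfolding rems_def by (metis imageI)
qed

text \<open>This reflection makes \<open>rems\<close> symmetric about \<open>max_rem / 2\<close>,
  which gives both its maximum and its sum.\<close>

definition flip_digits :: "(nat \<Rightarrow> nat) \<Rightarrow> nat \<Rightarrow> nat" where
  "flip_digits r = (\<lambda>i\<in>{..<n}. d i - 1 - r i)"

lemma flip_digits_in_digits: "flip_digits r \<in> digits"
  using d_pos by (auto simp: flip_digits_def digits_def intro!: diff_less_Suc[THEN order_less_le_trans])

lemma rem_add_flip: assumes "r \<in> digits" shows "rem r + rem (flip_digits r) = max_rem"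
proof -
  have "a ! i * r i + a ! i * flip_digits r i = a ! i * (d i - 1)" if "i < n" for i
  proof -
    have "r i + flip_digits r i = d i - 1"
      using digits_less[OF assms that] that by (simp add: flip_digits_def)
    then show ?thesis by (metis distrib_left)
  qed
  then show ?thesis by (simp add: rem_def max_rem_def sum.distrib[symmetric])
qed

lemma rems_le: assumes "e \<in> rems" shows "e \<le> max_rem"
  using assms rem_add_flip unfolding rems_def by (metis imageE le_add1)

lemma rems_symmetric: "(\<lambda>e. max_rem - e) ` rems = rems"
proof (rule card_subset_eq)
  have "max_rem - rem r = rem (flip_digits r)" if "r \<in> digits" for r
    using rem_add_flip[OF that] by simp
  then show "(\<lambda>e. max_rem - e) ` rems \<subseteq> rems"
    using flip_digits_in_digits unfolding rems_def by auto
  have "inj_on (\<lambda>e. max_rem - e) rems"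
    by (rule inj_onI) (use rems_le in \<open>metis diff_diff_cancel\<close>)
  then show "card ((\<lambda>e. max_rem - e) ` rems) = card rems" by (rule card_image)
qed (rule finite_rems)

lemma max_rem_in_rems: "max_rem \<in> rems"
  using rems_symmetric zero_in_rems by (metis diff_zero imageI)

lemma sum_rems: "2 * (\<Sum>e\<in>rems. e) = p * max_rem"
proof -
  have inj: "inj_on (\<lambda>e. max_rem - e) rems"
    by (rule inj_onI) (use rems_le in \<open>metis diff_diff_cancel\<close>)
  have "(\<Sum>e\<in>rems. e) = (\<Sum>e\<in>rems. max_rem - e)"
    using sum.reindex[OF inj, of "\<lambda>e. e"] rems_symmetric by simp
  then have "2 * (\<Sum>e\<in>rems. e) = (\<Sum>e\<in>rems. e + (max_rem - e))"
    by (simp add: sum.distrib)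
  also have "\<dots> = (\<Sum>e\<in>rems. max_rem)"
    by (rule sum.cong) (use rems_le in auto)
  finally show ?thesis by (simp add: card_rems)
qed

lemma rems_decomposition_unique:
  assumes "e \<in> rems" "e' \<in> rems" "e + p * q = e' + p * q'"
  shows "e = e' \<and> q = q'"
proof -
  have "[e = e'] (mod p)"
    using assms(3) by (metis cong_add_lcancel_0_nat cong_def mod_mult_self2)
  then have "e = e'" using assms(1,2) digits_eq_if_rem_cong unfolding rems_def by blast
  then show ?thesis using assms(3) p_pos by simp
qed

text \<open>The class of \<open>t\<close> modulo \<open>p\<close> has a representative
  \<open>rem r\<close>; were it at most \<open>t\<close>, then \<open>t\<close> would have a
  nonnegative quotient and be no gap.\<close>

lemma gap_cases:
  assumes "t \<in> gaps"
  shows "t < max_rem" and "nrep a t = 0"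
proof -
  obtain r where r: "r \<in> digits" "[rem r = t] (mod p)" using ex_rem_cong by metis
  have e: "rem r \<in> rems" using r(1) by (simp add: rems_def)
  have "t < rem r"
  proof (rule ccontr)
    assume "\<not> t < rem r"
    then have le: "rem r \<le> t" by simp
    then obtain q where "t = rem r + p * q"
      using r(2) cong_le_nat[of "rem r" t p] by (metis add.commute cong_sym mult.commute)
    then show False using assms e by (auto simp: gaps_def)
  qed
  then show "t < max_rem" using rems_le[OF e] by simp
  show "nrep a t = 0" using nrep_eq_0_if_less_rem[OF r(1) cong_sym[OF r(2)] \<open>t < rem r\<close>] .
qed

lemma finite_gaps: "finite gaps"
  by (rule finite_subset[of _ "{..<max_rem}"]) (use gap_cases(1) in auto)

lemma gaps_or_rem: obtains "t \<in> gaps" | e q where "e \<in> rems" "t = e + p * q"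
  by (auto simp: gaps_def)

section \<open>Levels: the numbers with a common quotient\<close>

definition level :: "nat \<Rightarrow> nat set" where
  "level q = (\<lambda>e. e + p * q) ` rems"

lemma nrep_level: "t \<in> level q \<Longrightarrow> nrep a t = nrep (map reduced [0..<n]) q"
  using nrep_rem_add by (auto simp: level_def rems_def)

lemma finite_level: "finite (level q)"
  by (simp add: level_def finite_rems)

lemma card_level: "card (level q) = p"
  unfolding level_def by (subst card_image) (auto simp: inj_on_def card_rems)

lemma sum_level: "2 * \<Sum>(level q) = 2 * p * (p * q) + p * max_rem"
proof -
  have "\<Sum>(level q) = (\<Sum>e\<in>rems. e + p * q)"
    unfolding level_def by (subst sum.reindex) (auto simp: inj_on_def)
  also have "\<dots> = (\<Sum>e\<in>rems. e) + p * (p * q)" by (simp add: sum.distrib card_rems)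
  finally show ?thesis using sum_rems by (simp add: algebra_simps)
qed

lemma level_disjoint: "t \<in> level q \<Longrightarrow> t \<in> level q' \<Longrightarrow> q = q'"
  using rems_decomposition_unique unfolding level_def by blast

lemma gaps_or_level: obtains "t \<in> gaps" | q where "t \<in> level q"
  using gaps_or_rem[of t] that by (auto simp: level_def)

lemma gaps_not_level: "t \<in> gaps \<Longrightarrow> t \<notin> level q"
  by (auto simp: gaps_def level_def)

definition upto_level :: "nat \<Rightarrow> nat set" where
  "upto_level s = gaps \<union> (\<Union>q\<le>s. level q)"

lemma upto_level_0: "upto_level 0 = gaps \<union> level 0"
  by (simp add: upto_level_def)

lemma upto_level_Suc: "upto_level (Suc s) = upto_level s \<union> level (Suc s)"
  by (auto simp: upto_level_def atMost_Suc)

lemma finite_upto_level: "finite (upto_level s)"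
  by (simp add: upto_level_def finite_gaps finite_level)

lemma disjoint_gaps_level: "gaps \<inter> level q = {}"
  using gaps_not_level by auto

lemma disjoint_upto_level: "upto_level s \<inter> level (Suc s) = {}"
proof -
  have "False" if "t \<in> upto_level s" "t \<in> level (Suc s)" for t
    using that gaps_not_level[of t "Suc s"] level_disjoint[of t _ "Suc s"]
    by (force simp: upto_level_def)
  then show ?thesis by auto
qed

text \<open>The levels run from 0 to \<open>s\<close>, so there are \<open>s + 1\<close> of them;
  hence the extra \<open>p\<close> in the constant.\<close>

lemma card_upto_level: "card (upto_level s) = s * p + (card gaps + p)"
proof (induction s)
  case 0
  show ?case
    by (simp add: upto_level_0 card_Un_disjoint finite_gaps finite_level disjoint_gaps_level card_level)
next
  case (Suc s)
  then show ?case
    by (simp add: upto_level_Suc card_Un_disjoint finite_upto_level finite_level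
        disjoint_upto_level card_level)
qed

text \<open>Doubling keeps the halves of the final formula within the naturals. The constant
  collects the gaps and level 0.\<close>

lemma sum_upto_level:
  "2 * \<Sum>(upto_level s) = (s * p) * (s * p) + (p + max_rem) * (s * p) + (2 * \<Sum>gaps + p * max_rem)"
proof (induction s)
  case 0
  have "\<Sum>(upto_level 0) = \<Sum>gaps + \<Sum>(level 0)"
    by (simp add: upto_level_0 sum.union_disjoint finite_gaps finite_level disjoint_gaps_level)
  then show ?case using sum_level[of 0] by simp
next
  case (Suc s)
  have "\<Sum>(upto_level (Suc s)) = \<Sum>(upto_level s) + \<Sum>(level (Suc s))"
    by (simp add: upto_level_Suc sum.union_disjoint finite_upto_level finite_level disjoint_upto_level)
  then show ?case using sum_level[of "Suc s"] Suc by (simp add: algebra_simps)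
qed

section \<open>Real form of the offset and generating functions of levels\<close>

lemma max_rem_real: "real max_rem = (\<Sum>i<n. real (a ! i) * (real (d i) - 1))"
  unfolding max_rem_def of_nat_sum
  by (intro sum.cong refl) (use d_pos in \<open>simp add: of_nat_diff Suc_leI\<close>)

lemma geometric_quotient:
  assumes "i < n"
  shows "(1 - fps_X ^ (d i * a ! i)) / (1 - fps_X ^ (a ! i)) = (\<Sum>r<d i. fps_X ^ (a ! i * r) :: real fps)"
proof -
  have "1 - fps_X ^ (d i * a ! i) = (1 - fps_X ^ (a ! i)) * (\<Sum>r<d i. fps_X ^ (a ! i * r) :: real fps)"
    using one_diff_power_eq[of "fps_X ^ (a ! i) :: real fps" "d i"]
    by (simp add: power_mult[symmetric] mult.commute)
  then show ?thesis using one_minus_X_power_neq_0[OF pos[OF assms]] by simp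
qed

text \<open>Each quotient is a finite geometric sum over one digit. Expanding the product runs over
  all digit vectors, and injectivity of \<open>rem\<close> prevents repeated exponents.\<close>

lemma rems_fps:
  "(\<Prod>i<n. (1 - fps_X ^ (d i * a ! i)) / (1 - fps_X ^ (a ! i))) = (\<Sum>e\<in>rems. fps_X ^ e :: real fps)"
proof -
  have "(\<Prod>i<n. (1 - fps_X ^ (d i * a ! i)) / (1 - fps_X ^ (a ! i)))
      = (\<Prod>i<n. \<Sum>r\<in>{..<d i}. fps_X ^ (a ! i * r) :: real fps)"
    by (intro prod.cong refl) (use geometric_quotient in simp)
  also have "\<dots> = (\<Sum>r\<in>digits. \<Prod>i<n. fps_X ^ (a ! i * r i))"
    unfolding digits_def by (rule prod_sum_PiE) auto
  also have "\<dots> = (\<Sum>r\<in>digits. fps_X ^ rem r)"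
    by (simp add: rem_def power_sum)
  also have "\<dots> = (\<Sum>e\<in>rems. fps_X ^ e)"
    unfolding rems_def by (simp add: sum.reindex[OF inj_on_rem])
  finally show ?thesis .
qed

lemma level_fps:
  "Abs_fps (\<lambda>t. if t \<in> level q then 1 else 0 :: real) = fps_X ^ (q * p) * (\<Sum>e\<in>rems. fps_X ^ e)"
proof -
  have "fps_X ^ (q * p) * (\<Sum>e\<in>rems. fps_X ^ e :: real fps) = (\<Sum>e\<in>rems. fps_X ^ (e + p * q))"
    by (simp add: sum_distrib_left power_add mult_ac)
  also have "\<dots> = (\<Sum>t\<in>level q. fps_X ^ t)"
    unfolding level_def by (subst sum.reindex) (auto simp: inj_on_def)
  also have "\<dots> = Abs_fps (\<lambda>t. if t \<in> level q then 1 else 0)"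
    by (rule fps_ext) (simp add: fps_sum_nth fps_X_power_nth finite_level)
  finally show ?thesis by simp
qed

lemma level_Suc: "t \<in> level (Suc q) \<longleftrightarrow> t \<ge> p \<and> t - p \<in> level q"
proof -
  have "t \<in> level (Suc q) \<longleftrightarrow> (\<exists>u\<in>level q. t = u + p)"
    by (auto simp: level_def add_ac)
  then show ?thesis by (metis add_diff_cancel_right' le_add2 le_add_diff_inverse2)
qed

text \<open>Shifting by \<open>p\<close> carries each level to the next, so multiplication by
  \<open>1 - fps_X ^ p\<close> leaves only the lowest level \<open>s\<close>.\<close>

lemma above_level_fps:
  "Abs_fps (\<lambda>t. if \<exists>q\<ge>s. t \<in> level q then 1 else 0 :: real)
    = fps_X ^ (s * p) / (1 - fps_X ^ p) * (\<Sum>e\<in>rems. fps_X ^ e)"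
  (is "?F = _")
proof -
  have "(1 - fps_X ^ p) * ?F = Abs_fps (\<lambda>t. if t \<in> level s then 1 else 0)"
  proof (rule fps_ext)
    fix t
    have shift: "(\<exists>q\<ge>s. t \<in> level (Suc q)) \<longleftrightarrow> t \<ge> p \<and> (\<exists>q\<ge>s. t - p \<in> level q)"
      using level_Suc by metis
    have split: "(\<exists>q\<ge>s. t \<in> level q) \<longleftrightarrow> t \<in> level s \<or> (\<exists>q\<ge>s. t \<in> level (Suc q))"
      (is "?L \<longleftrightarrow> ?R")
    proof
      assume ?L
      then obtain q where q: "q \<ge> s" "t \<in> level q" by blast
      show ?R
      proof (cases "q = s")
        case False
        then have "q = Suc (q - 1)" "q - 1 \<ge> s" using q(1) by auto
        then show ?thesis using q(2) by metis
      qed (use q(2) in simp)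
    next
      assume ?R
      then show ?L by (meson le_SucI le_refl)
    qed
    have disj: "t \<notin> level s" if "\<exists>q\<ge>s. t \<in> level (Suc q)"
      using that level_disjoint[of t s] by (metis Suc_n_not_le_n)
    have "fps_nth ((1 - fps_X ^ p) * ?F) t
        = (if \<exists>q\<ge>s. t \<in> level q then 1 else 0) - (if \<exists>q\<ge>s. t \<in> level (Suc q) then 1 else 0)"
      unfolding shift by (simp add: left_diff_distrib fps_X_power_mult_nth)
    also have "\<dots> = (if t \<in> level s then 1 else 0)"
      unfolding split using disj by auto
    finally show "fps_nth ((1 - fps_X ^ p) * ?F) t
        = fps_nth (Abs_fps (\<lambda>t. if t \<in> level s then 1 else 0)) t" by simp
  qed
  then have F: "(1 - fps_X ^ p) * ?F = fps_X ^ (s * p) * (\<Sum>e\<in>rems. fps_X ^ e)"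
    by (simp only: level_fps)
  have unit: "inverse (1 - fps_X ^ p) * (1 - fps_X ^ p :: real fps) = 1"
    using p_pos by (intro inverse_mult_eq_1) simp
  have "?F = inverse (1 - fps_X ^ p) * (1 - fps_X ^ p) * ?F" by (simp only: unit mult_1)
  also have "\<dots> = inverse (1 - fps_X ^ p) * (fps_X ^ (s * p) * (\<Sum>e\<in>rems. fps_X ^ e))"
    by (simp only: mult.assoc F)
  also have "\<dots> = fps_X ^ (s * p) / (1 - fps_X ^ p) * (\<Sum>e\<in>rems. fps_X ^ e)"
    using p_pos by (simp add: fps_divide_unit mult_ac)
  finally show ?thesis .
qed

text \<open>At a strict record \<open>s\<close>, comparing \<open>f q\<close> with
  \<open>f s\<close> is the same as comparing \<open>q\<close> with \<open>s\<close>. Gaps have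
  value 0, strictly below \<open>f s\<close>.\<close>

lemma level_sets:
  defines "f \<equiv> nrep (map reduced [0..<n])"
  assumes "f s > 0" and less: "\<And>q. q < s \<Longrightarrow> f q < f s" and greater: "\<And>q. q > s \<Longrightarrow> f q > f s"
  shows "nrep a (s * p) = f s"
    and "{t. nrep a t = f s} = level s"
    and "{t. nrep a t \<le> f s} = upto_level s"
    and "nrep a t \<ge> f s \<longleftrightarrow> (\<exists>q\<ge>s. t \<in> level q)"
proof -
  have in_level: "nrep a t = f q" if "t \<in> level q" for t q
    using nrep_level[OF that] by (simp add: f_def)
  have cmp: "f q = f s \<longleftrightarrow> q = s" "f q \<le> f s \<longleftrightarrow> q \<le> s" "f s \<le> f q \<longleftrightarrow> s \<le> q" for q
    using less[of q] greater[of q] by (cases q s rule: linorder_cases; force)+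
  have "s * p \<in> level s" using zero_in_rems by (force simp: level_def)
  then show "nrep a (s * p) = f s" by (rule in_level)
  have eq: "nrep a t = f s \<longleftrightarrow> t \<in> level s" for t
    by (cases t rule: gaps_or_level)
       (use gap_cases(2) gaps_not_level in_level cmp(1) level_disjoint assms(2) in \<open>metis less_irrefl\<close>)+
  then show "{t. nrep a t = f s} = level s" by auto
  have "nrep a t \<le> f s \<longleftrightarrow> t \<in> upto_level s" for t
  proof (cases t rule: gaps_or_level)
    case 1
    then show ?thesis using gap_cases(2)[OF 1] by (simp add: upto_level_def)
  next
    case (2 q)
    have "t \<in> level q' \<longleftrightarrow> q' = q" for q' using 2 level_disjoint[OF 2, of q'] by metis
    moreover have "t \<notin> gaps" using 2 gaps_not_level[of t q] by blast
    ultimately have "t \<in> upto_level s \<longleftrightarrow> q \<le> s" by (simp add: upto_level_def)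
    then show ?thesis using in_level[OF 2] cmp(2)[of q] by simp
  qed
  then show "{t. nrep a t \<le> f s} = upto_level s" by auto
  show "nrep a t \<ge> f s \<longleftrightarrow> (\<exists>q\<ge>s. t \<in> level q)"
  proof (cases t rule: gaps_or_level)
    case 1
    then show ?thesis using gap_cases(2)[OF 1] gaps_not_level[OF 1] assms(2) by simp
  next
    case (2 q)
    have "t \<in> level q' \<longleftrightarrow> q' = q" for q' using 2 level_disjoint[OF 2, of q'] by metis
    then show ?thesis using in_level[OF 2] cmp(3)[of q] by simp
  qed
qed

end

section \<open>Reading off the formulas at a record level\<close>

theorem theorem1p12:
  fixes a :: "nat list" and n p :: nat and d :: "nat \<Rightarrow> nat"
  assumes "length a = n" and "n \<ge> 2"
    and "\<forall>i<n. a ! i > 0"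
    and "Gcd (set a) = 1"
    and "\<forall>i<n. d i = Gcd (set (omit i a))"
    and "p = (\<Prod>i<n. d i)"
  shows "\<exists>C\<^sub>1 C\<^sub>2 :: real. \<forall>\<^sub>F s :: nat in sequentially. let k = nrep a (s * p) in
      finite {t. nrep a t \<le> k}
    \<and> g_eq a k = g_le a k
    \<and> real (g_le a k) = real s * real p + (\<Sum>i<n. (real (d i) - 1) * real (a ! i))
    \<and> h_eq a k = h_ge a k
    \<and> h_ge a k = s * p
    \<and> c_eq a k = p
    \<and> real (c_le a k) = real s * real p + C\<^sub>1
    \<and> real (s_eq a k) = real s * (real p)\<^sup>2
        + (\<Sum>i<n. real p * real (a ! i) * (real (d i) - 1) / 2)
    \<and> real (s_le a k) = 1 / 2 * (real s * real p)\<^sup>2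
        + ((real p + (\<Sum>i<n. real (a ! i) * (real (d i) - 1))) / 2) * (real s * real p) + C\<^sub>2
    \<and> F_eq a k = fps_X ^ (s * p)
        * (\<Prod>i<n. (1 - fps_X ^ (d i * a ! i)) / (1 - fps_X ^ (a ! i)))
    \<and> F_ge a k = fps_X ^ (s * p) / (1 - fps_X ^ p)
        * (\<Prod>i<n. (1 - fps_X ^ (d i * a ! i)) / (1 - fps_X ^ (a ! i)))"
proof -
  interpret coprime_vector a n p d
    by unfold_locales (use assms in blast)+
  let ?f = "nrep (map reduced [0..<n])"
  define C\<^sub>1 where "C\<^sub>1 = real (card gaps + p)"
  define C\<^sub>2 where "C\<^sub>2 = real (2 * \<Sum>gaps + p * max_rem) / 2"
  have "\<forall>\<^sub>F s in sequentially. ?f s > 0 \<and> (\<forall>q<s. ?f q < ?f s) \<and> (\<forall>q>s. ?f q > ?f s)"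
    using nrep_reduced_eventually_strict_increasing by (rule eventually_strict_record)
  then have "\<forall>\<^sub>F s :: nat in sequentially. let k = nrep a (s * p) in
      finite {t. nrep a t \<le> k}
    \<and> g_eq a k = g_le a k
    \<and> real (g_le a k) = real s * real p + (\<Sum>i<n. (real (d i) - 1) * real (a ! i))
    \<and> h_eq a k = h_ge a k
    \<and> h_ge a k = s * p
    \<and> c_eq a k = p
    \<and> real (c_le a k) = real s * real p + C\<^sub>1
    \<and> real (s_eq a k) = real s * (real p)\<^sup>2
        + (\<Sum>i<n. real p * real (a ! i) * (real (d i) - 1) / 2)
    \<and> real (s_le a k) = 1 / 2 * (real s * real p)\<^sup>2
        + ((real p + (\<Sum>i<n. real (a ! i) * (real (d i) - 1))) / 2) * (real s * real p) + C\<^sub>2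
    \<and> F_eq a k = fps_X ^ (s * p)
        * (\<Prod>i<n. (1 - fps_X ^ (d i * a ! i)) / (1 - fps_X ^ (a ! i)))
    \<and> F_ge a k = fps_X ^ (s * p) / (1 - fps_X ^ p)
        * (\<Prod>i<n. (1 - fps_X ^ (d i * a ! i)) / (1 - fps_X ^ (a ! i)))"
  proof eventually_elim
    case (elim s)
    define k where "k = nrep a (s * p)"
    have s: "?f s > 0" "\<And>q. q < s \<Longrightarrow> ?f q < ?f s" "\<And>q. q > s \<Longrightarrow> ?f s < ?f q"
      using elim by blast+
    have k: "k = ?f s" unfolding k_def using level_sets(1)[OF s] .
    have eq: "{t. nrep a t = k} = level s" unfolding k using level_sets(2)[OF s] .
    have le: "{t. nrep a t \<le> k} = upto_level s" unfolding k using level_sets(3)[OF s] .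
    have ge: "nrep a t \<ge> k \<longleftrightarrow> (\<exists>q\<ge>s. t \<in> level q)" for t unfolding k using level_sets(4)[OF s] .
    have top: "max_rem + p * s \<in> level s" using max_rem_in_rems by (simp add: level_def)
    have level_le: "t \<le> max_rem + p * q" if "t \<in> level q" for t q
      using that rems_le by (auto simp: level_def)
    have "g_eq a k = max_rem + p * s"
      unfolding g_eq_def eq by (rule Max_eqI) (use finite_level level_le top in auto)
    moreover have "g_le a k = max_rem + p * s"
      unfolding g_le_def le
    \<comment> \<open>Levels may interleave, so elements of every level up to \<open>s\<close> are
      compared with the top of level \<open>s\<close>; gaps lie below
      \<open>max_rem\<close>.\<close>
    proof (rule Max_eqI)
      fix t assume "t \<in> upto_level s"
      then consider "t \<in> gaps" | q where "q \<le> s" "t \<in> level q" by (auto simp: upto_level_def)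
      then show "t \<le> max_rem + p * s"
      proof cases
        case 1
        then show ?thesis using gap_cases(1)[of t] by simp
      next
        case 2
        have "p * q \<le> p * s" using 2(1) by simp
        then show ?thesis using level_le[OF 2(2)] by linarith
      qed
    qed (use finite_upto_level top in \<open>auto simp: upto_level_def\<close>)
    moreover have "real (max_rem + p * s) = real s * real p + (\<Sum>i<n. (real (d i) - 1) * real (a ! i))"
      by (simp add: max_rem_real mult.commute)
    moreover have bottom: "nrep a (s * p) = k" by (simp add: k_def)
    \<comment> \<open>The minimum \<open>s * p\<close> is attained because 0 lies in
      \<open>rems\<close>.\<close>
    have lower: "s * p \<le> t" if t: "t \<in> level q" "q \<ge> s" for t q
    proof -
      obtain e where "t = e + p * q" using t(1) by (auto simp: level_def)
      then have "p * q \<le> t" by simp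
      moreover have "p * s \<le> p * q" using t(2) by simp
      ultimately show ?thesis unfolding mult.commute[of s] by linarith
    qed
    have "h_eq a k = s * p"
      unfolding h_eq_def by (rule Least_equality) (use bottom eq lower[of _ s] in auto)
    moreover have "h_ge a k = s * p"
      unfolding h_ge_def by (rule Least_equality) (use bottom ge lower in auto)
    moreover have "c_eq a k = p" unfolding c_eq_def eq by (rule card_level)
    moreover have "real (c_le a k) = real s * real p + C\<^sub>1"
      unfolding c_le_def le card_upto_level C\<^sub>1_def by simp
    moreover have "real (s_eq a k) = real s * (real p)\<^sup>2
        + (\<Sum>i<n. real p * real (a ! i) * (real (d i) - 1) / 2)"
    proof -
      have "2 * real (s_eq a k) = real (2 * p * (p * s) + p * max_rem)"
        unfolding s_eq_def eq sum_level[symmetric] by simp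
      moreover have "(\<Sum>i<n. real p * real (a ! i) * (real (d i) - 1) / 2) = real p * real max_rem / 2"
        by (simp add: max_rem_real sum_distrib_left sum_divide_distrib mult.assoc)
      ultimately show ?thesis by (simp add: power2_eq_square field_simps)
    qed
    moreover have "real (s_le a k) = 1 / 2 * (real s * real p)\<^sup>2
        + ((real p + (\<Sum>i<n. real (a ! i) * (real (d i) - 1))) / 2) * (real s * real p) + C\<^sub>2"
    proof -
      have "2 * real (s_le a k) = real (2 * \<Sum>(upto_level s))"
        unfolding s_le_def le by simp
      also have "\<dots> = (real s * real p)\<^sup>2 + (real p + real max_rem) * (real s * real p) + 2 * C\<^sub>2"
        unfolding sum_upto_level C\<^sub>2_def by (simp add: power2_eq_square)
      finally show ?thesis unfolding max_rem_real[symmetric] by (simp add: field_simps)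
    qed
    moreover have "F_eq a k = fps_X ^ (s * p)
        * (\<Prod>i<n. (1 - fps_X ^ (d i * a ! i)) / (1 - fps_X ^ (a ! i)))"
    proof -
      have "nrep a t = k \<longleftrightarrow> t \<in> level s" for t using eq by blast
      then show ?thesis unfolding F_eq_def rems_fps level_fps[symmetric] by simp
    qed
    moreover have "F_ge a k = fps_X ^ (s * p) / (1 - fps_X ^ p)
        * (\<Prod>i<n. (1 - fps_X ^ (d i * a ! i)) / (1 - fps_X ^ (a ! i)))"
      unfolding F_ge_def rems_fps above_level_fps[symmetric] ge ..
    \<comment> \<open>Finiteness gives the maxima, cardinalities and sums their intended
      meaning.\<close>
    moreover have "finite {t. nrep a t \<le> k}" unfolding le by (rule finite_upto_level)
    ultimately show ?case unfolding Let_def k_def[symmetric] by simp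
  qed
  then show ?thesis by blast
qed

end
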